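(* Let $p_0,p_1,p_2\ge 0$ with $p:=p_0+p_1+p_2\in(0,1]$. Let $(B_0,B_1,B_2)=\{(B_0(t),B_1(t),B_2(t)):t=0,1,\dots\}$ be the multinomial process with parameters $p_0,p_1,p_2$, and set $M_1(t)=B_1(t)+B_0(t)$, $M_2(t)=B_2(t)+B_0(t)$ for $t=0,1,\dots$. Let $B=\{B(t):t=0,1,\dots\}$ be a homogeneous Binomial process with independent additive increments and parameter $p$, independent of a sequence $(I_{1i},I_{2i},I_{0i})$, $i=1,2,\dots$, of i.i.d. random vectors with $$\mathbb{P}(I_{1i}=1,I_{2i}=0,I_{0i}=0)=\frac{p_1}{p},\quad \mathbb{P}(I_{1i}=0,I_{2i}=1,I_{0i}=0)=\frac{p_2}{p},\quad \mathbb{P}(I_{1i}=0,I_{2i}=0,I_{0i}=1)=\frac{p_0}{p}.$$ Put $$A_1(t)=\sum_{i=0}^{B(t)}(I_{1i}+I_{0i}),\qquad A_2(t)=\sum_{i=0}^{B(t)}(I_{2i}+I_{0i}),\qquad t=0,1,\dots,$$ where $I_{10}=I_{20}=I_{00}=0$. Then the bivariate processes $(M_1,M_2)=\{(M_1(t),M_2(t)):t=0,1,\dots\}$ and $(A_1,A_2)=\{(A_1(t),A_2(t)):t=0,1,\dots\}$ have the same finite dimensional distributions.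
   Context: The multinomial process with parameters $p_0,p_1,p_2$ is the discrete time process $(B_0,B_1,B_2)$ starting at $(0,0,0)$, with independent and homogeneous (stationary) additive increments, whose one-time distributions are $$\mathbb{P}(B_0(t)=b_0,B_1(t)=b_1,B_2(t)=b_2)=\frac{t!}{b_0!\,b_1!\,b_2!\,(t-b_0-b_1-b_2)!}p_0^{b_0}p_1^{b_1}p_2^{b_2}(1-p)^{t-b_0-b_1-b_2}$$ for $b_0,b_1,b_2\in\{0,\dots,t\}$ with $b_0+b_1+b_2\le t$, and $0$ otherwise. A homogeneous Binomial process with parameter $p$ is a process $B$ with $B(0)=0$ and independent stationary increments such that $B(t)$ has the Binomial$(t,p)$ distribution. *)

theory Defs
  imports "HOL-Probability.Probability"
begin

text \<open>Discrete time processes are families \<^term>\<open>X :: nat \<Rightarrow> 'a \<Rightarrow> 's\<close> of random variables on a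
  probability space. All state spaces below are countable and carry the discrete sigma-algebra.\<close>

definition independent_increments ::
  "'a measure \<Rightarrow> (nat \<Rightarrow> 'a \<Rightarrow> 's::ab_group_add) \<Rightarrow> bool" where
  "independent_increments M X \<longleftrightarrow>
     (\<forall>n \<tau>. strict_mono_on {..n} \<tau> \<longrightarrow>
        prob_space.indep_vars M (\<lambda>_. count_space UNIV)
          (\<lambda>i \<omega>. X (\<tau> (Suc i)) \<omega> - X (\<tau> i) \<omega>) {..<n})"

definition stationary_increments ::
  "'a measure \<Rightarrow> (nat \<Rightarrow> 'a \<Rightarrow> 's::ab_group_add) \<Rightarrow> bool" where
  "stationary_increments M X \<longleftrightarrow>
     (\<forall>s t h. distr M (count_space UNIV) (\<lambda>\<omega>. X (s + h) \<omega> - X s \<omega>) =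
              distr M (count_space UNIV) (\<lambda>\<omega>. X (t + h) \<omega> - X t \<omega>))"

text \<open>Counting processes take values in \<^typ>\<open>nat\<close>, but their increments are formed in \<^typ>\<open>int\<close>,
  since subtraction on \<^typ>\<open>nat\<close> truncates.\<close>

definition multinomial_process ::
  "'a measure \<Rightarrow> real \<Rightarrow> real \<Rightarrow> real \<Rightarrow>
   (nat \<Rightarrow> 'a \<Rightarrow> nat) \<Rightarrow> (nat \<Rightarrow> 'a \<Rightarrow> nat) \<Rightarrow> (nat \<Rightarrow> 'a \<Rightarrow> nat) \<Rightarrow> bool" where
  "multinomial_process M p0 p1 p2 B0 B1 B2 \<longleftrightarrow>
     (\<forall>t. B0 t \<in> M \<rightarrow>\<^sub>M count_space UNIV \<and> B1 t \<in> M \<rightarrow>\<^sub>M count_space UNIV \<and>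
          B2 t \<in> M \<rightarrow>\<^sub>M count_space UNIV) \<and>
     (AE \<omega> in M. B0 0 \<omega> = 0 \<and> B1 0 \<omega> = 0 \<and> B2 0 \<omega> = 0) \<and>
     independent_increments M (\<lambda>t \<omega>. (int (B0 t \<omega>), int (B1 t \<omega>), int (B2 t \<omega>))) \<and>
     stationary_increments M (\<lambda>t \<omega>. (int (B0 t \<omega>), int (B1 t \<omega>), int (B2 t \<omega>))) \<and>
     (\<forall>t b0 b1 b2.
        measure M {\<omega> \<in> space M. B0 t \<omega> = b0 \<and> B1 t \<omega> = b1 \<and> B2 t \<omega> = b2} =
          (if b0 + b1 + b2 \<le> t
           then fact t / (fact b0 * fact b1 * fact b2 * fact (t - b0 - b1 - b2))
                  * p0 ^ b0 * p1 ^ b1 * p2 ^ b2 * (1 - (p0 + p1 + p2)) ^ (t - b0 - b1 - b2)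
           else 0))"

definition binomial_process :: "'a measure \<Rightarrow> real \<Rightarrow> (nat \<Rightarrow> 'a \<Rightarrow> nat) \<Rightarrow> bool" where
  "binomial_process M p B \<longleftrightarrow>
     (\<forall>t. B t \<in> M \<rightarrow>\<^sub>M count_space UNIV) \<and>
     (AE \<omega> in M. B 0 \<omega> = 0) \<and>
     independent_increments M (\<lambda>t \<omega>. int (B t \<omega>)) \<and>
     stationary_increments M (\<lambda>t \<omega>. int (B t \<omega>)) \<and>
     (\<forall>t. distr M (count_space UNIV) (B t) = measure_pmf (binomial_pmf t p))"

definition iid_vars :: "'a measure \<Rightarrow> (nat \<Rightarrow> 'a \<Rightarrow> 's) \<Rightarrow> nat set \<Rightarrow> bool" where
  "iid_vars M X J \<longleftrightarrow>
     prob_space.indep_vars M (\<lambda>_. count_space UNIV) X J \<and>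
     (\<forall>i\<in>J. \<forall>j\<in>J. distr M (count_space UNIV) (X i) = distr M (count_space UNIV) (X j))"

text \<open>Unlike \<^const>\<open>prob_space.indep_var\<close>, this allows the two random elements to have
  different types.\<close>

definition indep_elements ::
  "'a measure \<Rightarrow> 's measure \<Rightarrow> ('a \<Rightarrow> 's) \<Rightarrow> 't measure \<Rightarrow> ('a \<Rightarrow> 't) \<Rightarrow> bool" where
  "indep_elements M S X T Y \<longleftrightarrow>
     X \<in> M \<rightarrow>\<^sub>M S \<and> Y \<in> M \<rightarrow>\<^sub>M T \<and>
     prob_space.indep_set M {X -` A \<inter> space M | A. A \<in> sets S} {Y -` A \<inter> space M | A. A \<in> sets T}"

definition fin_dim_distr ::
  "'a measure \<Rightarrow> (nat \<Rightarrow> 'a \<Rightarrow> 's) \<Rightarrow> nat set \<Rightarrow> (nat \<Rightarrow> 's) measure" where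
  "fin_dim_distr M X J = distr M (Pi\<^sub>M J (\<lambda>_. count_space UNIV)) (\<lambda>\<omega>. \<lambda>t\<in>J. X t \<omega>)"

text \<open>The measurability clauses ensure that the image measures are meaningful.\<close>

definition same_fin_dim_distrs ::
  "'a measure \<Rightarrow> (nat \<Rightarrow> 'a \<Rightarrow> 's) \<Rightarrow> 'b measure \<Rightarrow> (nat \<Rightarrow> 'b \<Rightarrow> 's) \<Rightarrow> bool" where
  "same_fin_dim_distrs M X N Y \<longleftrightarrow>
     (\<forall>t. X t \<in> M \<rightarrow>\<^sub>M count_space UNIV) \<and>
     (\<forall>t. Y t \<in> N \<rightarrow>\<^sub>M count_space UNIV) \<and>
     (\<forall>J. finite J \<longrightarrow> fin_dim_distr M X J = fin_dim_distr N Y J)"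

end

theory Submission
  imports Defs
begin

text \<open>Both processes have independent stationary increments with the same one-step law, so they give
  the same probability to every finite path. For \<open>(M\<^sub>1, M\<^sub>2)\<close> this is inherited from the multinomial
  process by an additive map. For \<open>(A\<^sub>1, A\<^sub>2)\<close>, a random walk with nonzero jumps run by the clock \<open>B\<close>,
  a path of the process almost surely forces a unique path of \<open>B\<close>; by independence the
  probability of the path factors into one for \<open>B\<close> and one for the walk, and both are
  products over the steps: a step \<open>0\<close> contributes \<open>1 - p\<close>, a step \<open>d \<noteq> 0\<close> contributes \<open>p\<close> times
  the probability that the walk jumps by \<open>d\<close>, which is the law of the multinomial increment.\<close>

section \<open>Measurability into discrete spaces\<close>

text \<open>Once the value of \<open>f x\<close> is frozen, only a function of \<open>g x\<close>
  remains, and countably many frozen values glue together measurably. No product sigma-algebra on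
  pairs has to be considered.\<close>

lemma measurable_count_space_binary:
  fixes f :: "'a \<Rightarrow> 'x::countable"
  assumes f: "f \<in> M \<rightarrow>\<^sub>M count_space UNIV" and g: "g \<in> M \<rightarrow>\<^sub>M count_space UNIV"
  shows "(\<lambda>x. h (f x) (g x)) \<in> M \<rightarrow>\<^sub>M count_space UNIV"
  by (rule measurable_compose_countable[OF _ f]) (rule measurable_compose[OF g], simp)

lemma measurable_count_space_sum:
  fixes f :: "'i \<Rightarrow> 'a \<Rightarrow> 's::{countable, comm_monoid_add}"
  assumes "\<And>i. i \<in> I \<Longrightarrow> f i \<in> M \<rightarrow>\<^sub>M count_space UNIV"
  shows "(\<lambda>x. \<Sum>i\<in>I. f i x) \<in> M \<rightarrow>\<^sub>M count_space UNIV"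
  using assms
  by (induction I rule: infinite_finite_induct)
     (auto intro!: measurable_count_space_binary[where h = "(+)"])

lemma measurable_path_event:
  fixes X :: "nat \<Rightarrow> 'a \<Rightarrow> 's"
  assumes "\<And>k. k \<in> K \<Longrightarrow> X k \<in> M \<rightarrow>\<^sub>M count_space UNIV"
  shows "{\<omega> \<in> space M. \<forall>k\<in>K. X k \<omega> = a k} \<in> sets M"
proof -
  have "{\<omega> \<in> space M. X k \<omega> = a k} \<in> sets M" if "k \<in> K" for k
    using measurable_sets[OF assms[OF that], of "{a k}"] by (simp add: vimage_def Int_def conj_commute)
  then show ?thesis
    by (intro sets.sets_Collect_countable_All') auto
qed

section \<open>Additive images of processes\<close>

text \<open>An additive map commutes with differences, so the new increments are images of the old
  ones, and images of independent variables stay independent.\<close>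

lemma independent_increments_additive:
  fixes X :: "nat \<Rightarrow> 'a \<Rightarrow> 's::ab_group_add"
  assumes "prob_space M" and "Modules.additive f" and "independent_increments M X"
  shows "independent_increments M (\<lambda>t \<omega>. f (X t \<omega>))"
  unfolding independent_increments_def
proof (intro allI impI)
  fix n :: nat and \<tau> :: "nat \<Rightarrow> nat"
  assume "strict_mono_on {..n} \<tau>"
  then have "prob_space.indep_vars M (\<lambda>_. count_space UNIV)
      (\<lambda>i \<omega>. X (\<tau> (Suc i)) \<omega> - X (\<tau> i) \<omega>) {..<n}"
    using assms(3) by (simp add: independent_increments_def)
  from prob_space.indep_vars_compose2[OF assms(1) this, of "\<lambda>_. f" "\<lambda>_. count_space UNIV"]
  show "prob_space.indep_vars M (\<lambda>_. count_space UNIV)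
      (\<lambda>i \<omega>. f (X (\<tau> (Suc i)) \<omega>) - f (X (\<tau> i) \<omega>)) {..<n}"
    by (simp add: Modules.additive.diff[OF assms(2)])
qed

text \<open>The laws of the new increments are image laws of the old ones under \<open>f\<close>.
  Countability makes the difference of two states measurable.\<close>

lemma stationary_increments_additive:
  fixes X :: "nat \<Rightarrow> 'a \<Rightarrow> 's::{countable, ab_group_add}"
  assumes "Modules.additive f" and "\<And>t. X t \<in> M \<rightarrow>\<^sub>M count_space UNIV" and "stationary_increments M X"
  shows "stationary_increments M (\<lambda>t \<omega>. f (X t \<omega>))"
  unfolding stationary_increments_def
proof (intro allI)
  fix s t h
  have *: "distr M (count_space UNIV) (\<lambda>\<omega>. f (X (s + h) \<omega>) - f (X s \<omega>)) =
      distr (distr M (count_space UNIV) (\<lambda>\<omega>. X (s + h) \<omega> - X s \<omega>)) (count_space UNIV) f" for s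
    by (subst distr_distr)
       (auto intro!: measurable_count_space_binary[where h = "(-)"] assms simp: comp_def Modules.additive.diff[OF assms(1)])
  show "distr M (count_space UNIV) (\<lambda>\<omega>. f (X (s + h) \<omega>) - f (X s \<omega>)) =
      distr M (count_space UNIV) (\<lambda>\<omega>. f (X (t + h) \<omega>) - f (X t \<omega>))"
    using assms(3) unfolding * stationary_increments_def by metis
qed

context prob_space
begin

section \<open>Path probabilities for independent stationary increments\<close>

lemma prob_increment:
  fixes X :: "nat \<Rightarrow> 'a \<Rightarrow> 's::{countable, ab_group_add}"
  assumes X[measurable]: "\<And>t. X t \<in> M \<rightarrow>\<^sub>M count_space UNIV" and X0: "AE \<omega> in M. X 0 \<omega> = 0"
    and stat: "stationary_increments M X"
  shows "\<P>(\<omega> in M. X (Suc k) \<omega> - X k \<omega> = d) = \<P>(\<omega> in M. X 1 \<omega> = d)"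
proof -
  have [measurable]: "(\<lambda>\<omega>. X (s + 1) \<omega> - X s \<omega>) \<in> M \<rightarrow>\<^sub>M count_space UNIV" for s
    by (intro measurable_count_space_binary[where h = "(-)"] X)
  have *: "\<P>(\<omega> in M. X (s + 1) \<omega> - X s \<omega> = d) =
      measure (distr M (count_space UNIV) (\<lambda>\<omega>. X (s + 1) \<omega> - X s \<omega>)) {d}" for s
    by (subst measure_distr) (auto intro!: arg_cong[where f = prob])
  \<comment> \<open>Stationarity moves the increment to time 0, where it almost surely equals
    \<open>X 1\<close>.\<close>
  have "\<P>(\<omega> in M. X (k + 1) \<omega> - X k \<omega> = d) = \<P>(\<omega> in M. X (0 + 1) \<omega> - X 0 \<omega> = d)"
    using stat unfolding * stationary_increments_def by metis
  also have "\<dots> = \<P>(\<omega> in M. X 1 \<omega> = d)"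
    by (rule prob_eq_AE) (use X0 in \<open>auto, measurable\<close>)
  finally show ?thesis by simp
qed

text \<open>For a process started at 0, a path up to time \<open>n\<close> carries the same
  information as its \<open>n\<close> unit increments. Independence turns their joint probability
  into a product, and stationarity reduces each factor to the first increment.\<close>

lemma prob_increments_path:
  fixes X :: "nat \<Rightarrow> 'a \<Rightarrow> 's::{countable, ab_group_add}"
  assumes X: "\<And>t. X t \<in> M \<rightarrow>\<^sub>M count_space UNIV" and X0: "AE \<omega> in M. X 0 \<omega> = 0"
    and ind: "independent_increments M X" and stat: "stationary_increments M X"
    and a0: "a 0 = 0"
  shows "\<P>(\<omega> in M. \<forall>k\<le>n. X k \<omega> = a k) = (\<Prod>k<n. \<P>(\<omega> in M. X 1 \<omega> = a (Suc k) - a k))"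
proof -
  have iv: "indep_vars (\<lambda>_. count_space UNIV) (\<lambda>k \<omega>. X (Suc k) \<omega> - X k \<omega>) {..<n}"
    using ind[unfolded independent_increments_def, rule_format, of n id] by (simp add: strict_mono_on_def)
  have iff: "(\<forall>k\<le>n. X k \<omega> = a k) \<longleftrightarrow> (\<forall>k\<in>{..<n}. X (Suc k) \<omega> - X k \<omega> = a (Suc k) - a k)"
    if "X 0 \<omega> = 0" for \<omega>
  proof
    assume R: "\<forall>k\<in>{..<n}. X (Suc k) \<omega> - X k \<omega> = a (Suc k) - a k"
    have "k \<le> n \<Longrightarrow> X k \<omega> = a k" for k
    proof (induction k)
      case (Suc k)
      then have "X (Suc k) \<omega> - X k \<omega> = a (Suc k) - a k" "X k \<omega> = a k" using R[rule_format, of k] by auto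
      then show ?case by (metis diff_add_cancel)
    qed (simp add: a0 that)
    then show "\<forall>k\<le>n. X k \<omega> = a k" by blast
  qed auto
  have "\<P>(\<omega> in M. \<forall>k\<in>{..n}. X k \<omega> = a k) =
      \<P>(\<omega> in M. \<forall>k\<in>{..<n}. X (Suc k) \<omega> - X k \<omega> = a (Suc k) - a k)"
  proof (intro prob_eq_AE measurable_path_event measurable_count_space_binary[where h = "(-)"] X)
    show "AE \<omega> in M. (\<forall>k\<in>{..n}. X k \<omega> = a k) \<longleftrightarrow>
        (\<forall>k\<in>{..<n}. X (Suc k) \<omega> - X k \<omega> = a (Suc k) - a k)"
      using X0 by eventually_elim (simp only: iff[unfolded Ball_def] Ball_def atMost_iff)
  qed
  also have "\<dots> = (\<Prod>k<n. \<P>(\<omega> in M. X (Suc k) \<omega> - X k \<omega> = a (Suc k) - a k))"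
  \<comment> \<open>The product rule for independent variables needs a nonempty index set; for
    \<open>n = 0\<close> both sides are 1.\<close>
  proof (cases "n = 0")
    case False
    have "\<P>(\<omega> in M. \<forall>k\<in>{..<n}. X (Suc k) \<omega> - X k \<omega> = a (Suc k) - a k) =
        prob (\<Inter>k\<in>{..<n}. (\<lambda>\<omega>. X (Suc k) \<omega> - X k \<omega>) -` {a (Suc k) - a k} \<inter> space M)"
      using False by (intro arg_cong[where f = prob]) auto
    also have "\<dots> = (\<Prod>k<n. prob ((\<lambda>\<omega>. X (Suc k) \<omega> - X k \<omega>) -` {a (Suc k) - a k} \<inter> space M))"
      using False by (intro indep_varsD_finite[OF iv]) auto
    also have "\<dots> = (\<Prod>k<n. \<P>(\<omega> in M. X (Suc k) \<omega> - X k \<omega> = a (Suc k) - a k))"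
      by (intro prod.cong arg_cong[where f = prob]) auto
    finally show ?thesis .
  qed (simp add: prob_space)
  finally show ?thesis
    by (simp add: prob_increment[OF X X0 stat] Ball_def)
qed

section \<open>Random walk read along a deterministic clock\<close>

text \<open>The clock \<open>b\<close> ticks exactly when \<open>a\<close> moves, so each move
  consumes one fresh jump. The path so far depends on the first \<open>b n\<close> jumps only, and
  the next jump is independent of them; a step at rest repeats the previous condition and
  contributes 1.\<close>

lemma prob_walk_path:
  fixes J :: "nat \<Rightarrow> 'a \<Rightarrow> 's::{countable, ab_group_add}"
  assumes ind: "indep_vars (\<lambda>_. count_space UNIV) J {1..}"
    and r: "\<And>i x. 1 \<le> i \<Longrightarrow> \<P>(\<omega> in M. J i \<omega> = x) = r x"
    and a0: "a 0 = 0" and b0: "b 0 = 0"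
    and b: "\<And>k. b (Suc k) = b k + (if a (Suc k) = a k then 0 else 1)"
  shows "\<P>(\<omega> in M. \<forall>k\<le>n. (\<Sum>i=1..b k. J i \<omega>) = a k) =
    (\<Prod>k<n. if a (Suc k) = a k then 1 else r (a (Suc k) - a k))"
proof (induction n)
  case (Suc n)
  let ?S = "\<lambda>k \<omega>. \<Sum>i=1..b k. J i \<omega>"
  let ?E = "\<lambda>n \<omega>. \<forall>k\<le>n. ?S k \<omega> = a k"
  show ?case
  proof (cases "a (Suc n) = a n")
    case True
    then have "?E (Suc n) \<omega> = ?E n \<omega>" for \<omega> by (auto simp: le_Suc_eq b)
    with True Suc show ?thesis by simp
  next
    case False
    let ?d = "a (Suc n) - a n" and ?m = "b n"
    have mono: "k \<le> n \<Longrightarrow> b k \<le> ?m" for k by (rule lift_Suc_mono_le) (auto simp: b)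
    have iff: "?E (Suc n) \<omega> \<longleftrightarrow> ?E n \<omega> \<and> J (Suc ?m) \<omega> = ?d" for \<omega>
    proof -
      have "?E (Suc n) \<omega> \<longleftrightarrow> ?E n \<omega> \<and> ?S (Suc n) \<omega> = a (Suc n)"
        by (metis le_Suc_eq order_refl)
      moreover have "?S (Suc n) \<omega> = a (Suc n) \<longleftrightarrow> J (Suc ?m) \<omega> = ?d" if "?S n \<omega> = a n"
        using False that by (simp add: b eq_diff_eq add.commute)
      ultimately show ?thesis by blast
    qed
    let ?f = "\<lambda>x :: nat \<Rightarrow> 's. \<forall>k\<le>n. (\<Sum>i=1..b k. x i) = a k" and ?g = "\<lambda>x :: nat \<Rightarrow> 's. x (Suc ?m) = ?d"
    \<comment> \<open>Restricting to the first \<open>b n\<close> jumps loses nothing, because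
      \<open>b k \<le> b n\<close> for all earlier times.\<close>
    have f: "?f (restrict (\<lambda>i. J i \<omega>) {1..?m}) \<longleftrightarrow> ?E n \<omega>" for \<omega>
      using mono by (intro all_cong arg_cong2[where f = "(=)"] sum.cong) fastforce+
    have "indep_var (PiM {1..?m} (\<lambda>_. count_space UNIV)) (\<lambda>\<omega>. restrict (\<lambda>i. J i \<omega>) {1..?m})
        (PiM {Suc ?m} (\<lambda>_. count_space UNIV)) (\<lambda>\<omega>. restrict (\<lambda>i. J i \<omega>) {Suc ?m})"
      by (rule indep_var_restrict[OF ind]) auto
    \<comment> \<open>Events are treated as Boolean variables; on a finite product of countable
      discrete spaces every predicate is measurable.\<close>
    then have "indep_var (count_space UNIV) (?f \<circ> (\<lambda>\<omega>. restrict (\<lambda>i. J i \<omega>) {1..?m}))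
        (count_space UNIV) (?g \<circ> (\<lambda>\<omega>. restrict (\<lambda>i. J i \<omega>) {Suc ?m}))"
      by (rule indep_var_compose) (simp_all add: count_space_PiM_finite)
    from indep_varD[OF this, of "{True}" "{True}"]
    have "\<P>(\<omega> in M. ?E n \<omega> \<and> J (Suc ?m) \<omega> = ?d) = \<P>(\<omega> in M. ?E n \<omega>) * \<P>(\<omega> in M. J (Suc ?m) \<omega> = ?d)"
      unfolding comp_def f by (simp add: vimage_def Int_def conj_commute)
    then show ?thesis unfolding iff using False Suc by (simp add: r)
  qed
qed (simp add: a0 b0 prob_space)

section \<open>Laws with finite support\<close>

text \<open>Recovers the support from point probabilities alone: masses adding up to 1 leave nothing
  outside. It serves the clock steps, the multinomial step and the jump vectors.\<close>

lemma AE_in_finite_support: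
  assumes X: "X \<in> M \<rightarrow>\<^sub>M count_space UNIV" and F: "finite F"
    and "(\<Sum>x\<in>F. \<P>(\<omega> in M. X \<omega> = x)) = 1"
  shows "AE \<omega> in M. X \<omega> \<in> F"
proof -
  have "prob (X -` F \<inter> space M) = prob (\<Union>x\<in>F. X -` {x} \<inter> space M)"
    by (rule arg_cong[where f = prob]) auto
  also have "\<dots> = (\<Sum>x\<in>F. prob (X -` {x} \<inter> space M))"
    by (rule finite_measure_finite_Union[OF F]) (auto simp: disjoint_family_on_def intro: measurable_sets[OF X])
  also have "\<dots> = 1"
    using assms(3) by (simp add: vimage_def Int_def conj_commute)
  finally have "AE \<omega> in M. \<omega> \<in> X -` F \<inter> space M"
    using measurable_sets[OF X, of F] by (simp add: prob_eq_1)
  then show ?thesis by eventually_elim auto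
qed

text \<open>The finite support turns a fibre of \<open>f\<close>, possibly infinite, into a finite
  disjoint union of points.\<close>

lemma prob_image_finite_support:
  assumes X: "X \<in> M \<rightarrow>\<^sub>M count_space UNIV" and F: "finite F"
    and "AE \<omega> in M. X \<omega> \<in> F"
  shows "\<P>(\<omega> in M. f (X \<omega>) = y) = (\<Sum>x\<in>F. if f x = y then \<P>(\<omega> in M. X \<omega> = x) else 0)"
proof -
  have ev: "{\<omega> \<in> space M. X \<omega> \<in> S} \<in> events" for S
    using measurable_sets[OF X, of S] by (simp add: vimage_def Int_def conj_commute)
  have "\<P>(\<omega> in M. f (X \<omega>) = y) = \<P>(\<omega> in M. X \<omega> \<in> {x \<in> F. f x = y})"
    using assms(3) ev[of "{x. f x = y}"] by (intro prob_eq_AE ev) auto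
  also have "\<dots> = prob (\<Union>x\<in>{x \<in> F. f x = y}. X -` {x} \<inter> space M)"
    by (rule arg_cong[where f = prob]) auto
  also have "\<dots> = (\<Sum>x\<in>{x \<in> F. f x = y}. prob (X -` {x} \<inter> space M))"
    using F by (intro finite_measure_finite_Union)
      (auto simp: disjoint_family_on_def intro: measurable_sets[OF X])
  finally show ?thesis by (simp add: vimage_def Int_def conj_commute flip: sum.inter_filter[OF F])
qed

section \<open>Random walk read along an independent random clock\<close>

text \<open>The condition \<open>r 0 = 0\<close> makes the clock recoverable from the walk. The
  vectors \<open>V i\<close> are kept apart from the jumps \<open>g (V i)\<close> because
  independence from the clock is given for the vectors.\<close>

lemma prob_subordinated_path:
  fixes B :: "nat \<Rightarrow> 'a \<Rightarrow> nat" and V :: "nat \<Rightarrow> 'a \<Rightarrow> 'v" and g :: "'v \<Rightarrow> 's::{countable, ab_group_add}"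
  assumes B: "\<And>t. B t \<in> M \<rightarrow>\<^sub>M count_space UNIV" and B0: "AE \<omega> in M. B 0 \<omega> = 0"
    and ind: "independent_increments M (\<lambda>t \<omega>. int (B t \<omega>))"
    and stat: "stationary_increments M (\<lambda>t \<omega>. int (B t \<omega>))"
    and B1_0: "\<P>(\<omega> in M. B 1 \<omega> = 0) = 1 - p" and B1_1: "\<P>(\<omega> in M. B 1 \<omega> = 1) = p"
    and V: "indep_vars (\<lambda>_. count_space UNIV) V {1..}"
    and r: "\<And>i x. 1 \<le> i \<Longrightarrow> \<P>(\<omega> in M. g (V i \<omega>) = x) = r x" and r0: "r 0 = 0"
    and indep: "indep_elements M (Pi\<^sub>M UNIV (\<lambda>_. count_space UNIV)) (\<lambda>\<omega> t. B t \<omega>)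
       (Pi\<^sub>M {1..} (\<lambda>_. count_space UNIV)) (\<lambda>\<omega>. \<lambda>i\<in>{1..}. V i \<omega>)"
    and a0: "a 0 = 0"
  shows "\<P>(\<omega> in M. \<forall>k\<le>n. (\<Sum>i=1..B k \<omega>. g (V i \<omega>)) = a k) =
    (\<Prod>k<n. if a (Suc k) = a k then 1 - p else p * r (a (Suc k) - a k))"
proof -
  \<comment> \<open>The number of moves of \<open>a\<close> before time \<open>k\<close>: the only
    clock reading compatible with the path when all jumps are nonzero.\<close>
  define b :: "nat \<Rightarrow> nat" where "b k = (\<Sum>j<k. if a (Suc j) = a j then 0 else 1)" for k
  have b0: "b 0 = 0" and b: "b (Suc k) = b k + (if a (Suc k) = a k then 0 else 1)" for k
    by (simp_all add: b_def)
  let ?W = "\<lambda>m \<omega>. \<Sum>i=1..m. g (V i \<omega>)"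
  have intB: "(\<lambda>\<omega>. int (B t \<omega>)) \<in> M \<rightarrow>\<^sub>M count_space UNIV" for t
    by (rule measurable_compose[OF B]) simp
  have V_meas: "V i \<in> M \<rightarrow>\<^sub>M count_space UNIV" if "1 \<le> i" for i
    using V that by (auto simp: indep_vars_def)
  have gV_meas: "(\<lambda>\<omega>. g (V i \<omega>)) \<in> M \<rightarrow>\<^sub>M count_space UNIV" if "1 \<le> i" for i
    by (rule measurable_compose[OF V_meas[OF that]]) simp
  have W_meas: "?W m \<in> M \<rightarrow>\<^sub>M count_space UNIV" for m
    by (intro measurable_count_space_sum gV_meas) auto
  have WB_meas: "(\<lambda>\<omega>. ?W (B k \<omega>) \<omega>) \<in> M \<rightarrow>\<^sub>M count_space UNIV" for k
    by (rule measurable_compose_countable[OF W_meas B])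
  have int0: "AE \<omega> in M. int (B 0 \<omega>) = 0"
    using B0 by simp
  have intB1: "\<P>(\<omega> in M. int (B 1 \<omega>) = 0) = 1 - p" "\<P>(\<omega> in M. int (B 1 \<omega>) = 1) = p"
    using B1_0 B1_1 by simp_all
  \<comment> \<open>The first clock step takes the values 0 and 1 with total probability 1; by
    stationarity so does every step.\<close>
  have "AE \<omega> in M. int (B (Suc k) \<omega>) - int (B k \<omega>) \<in> {0, 1}" for k
    by (rule AE_in_finite_support)
       (simp_all add: measurable_count_space_binary[where h = "(-)", OF intB intB]
          prob_increment[OF intB int0 stat] intB1[simplified])
  then have steps: "AE \<omega> in M. \<forall>k. int (B (Suc k) \<omega>) - int (B k \<omega>) \<in> {0, 1}"
    by (simp add: AE_all_countable)
  have "AE \<omega> in M. 1 \<le> i \<longrightarrow> g (V i \<omega>) \<noteq> 0" for i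
  proof (cases "1 \<le> i")
    case True
    have "{\<omega> \<in> space M. g (V i \<omega>) = 0} \<in> events"
      using measurable_sets[OF gV_meas[OF True], of "{0}"] by (simp add: vimage_def Int_def conj_commute)
    then show ?thesis using r[OF True, of 0] r0 by (simp add: prob_eq_0)
  qed simp
  then have nonzero: "AE \<omega> in M. \<forall>i. 1 \<le> i \<longrightarrow> g (V i \<omega>) \<noteq> 0"
    by (simp add: AE_all_countable)
  txt \<open>As the jumps of the walk are almost surely nonzero, the path \<^term>\<open>a\<close> determines
    the path \<^term>\<open>b\<close> of the clock: it ticks exactly when \<^term>\<open>a\<close> moves.\<close>
  have iff: "(\<forall>k\<le>n. ?W (B k \<omega>) \<omega> = a k) \<longleftrightarrow> (\<forall>k\<le>n. B k \<omega> = b k) \<and> (\<forall>k\<le>n. ?W (b k) \<omega> = a k)"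
    if "B 0 \<omega> = 0" and st: "\<forall>k. int (B (Suc k) \<omega>) - int (B k \<omega>) \<in> {0, 1}"
      and nz: "\<forall>i. 1 \<le> i \<longrightarrow> g (V i \<omega>) \<noteq> 0" for \<omega>
  proof
    assume L: "\<forall>k\<le>n. ?W (B k \<omega>) \<omega> = a k"
    have "k \<le> n \<Longrightarrow> B k \<omega> = b k" for k
    proof (induction k)
      case (Suc k)
      have W: "?W (B k \<omega>) \<omega> = a k" "?W (B (Suc k) \<omega>) \<omega> = a (Suc k)"
        using L Suc.prems by (meson Suc_leD)+
      consider "B (Suc k) \<omega> = B k \<omega>" | "B (Suc k) \<omega> = Suc (B k \<omega>)"
        using st[rule_format, of k] by fastforce
      then show ?case
      proof cases
        case 2
        \<comment> \<open>A tick adds exactly one jump, which is nonzero, so \<open>a\<close> moves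
          as well.\<close>
        then have "a (Suc k) = a k + g (V (Suc (B k \<omega>)) \<omega>)"
          using W by simp
        then have "a (Suc k) \<noteq> a k" using nz by simp
        then show ?thesis using 2 Suc by (simp add: b)
      qed (use W Suc b in auto)
    qed (simp add: that b0)
    then show "(\<forall>k\<le>n. B k \<omega> = b k) \<and> (\<forall>k\<le>n. ?W (b k) \<omega> = a k)" using L by auto
  qed auto
  let ?E = "{\<omega> \<in> space M. \<forall>k\<in>{..n}. B k \<omega> = b k}"
  let ?F = "{\<omega> \<in> space M. \<forall>k\<in>{..n}. ?W (b k) \<omega> = a k}"
  \<comment> \<open>Independence concerns whole sequences, so both events are rewritten as preimages
    of measurable sets of sequences.\<close>
  let ?PB = "Pi\<^sub>M UNIV (\<lambda>_. count_space UNIV) :: (nat \<Rightarrow> nat) measure"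
  let ?PV = "Pi\<^sub>M {1..} (\<lambda>_. count_space UNIV) :: (nat \<Rightarrow> 'v) measure"
  let ?SB = "{x \<in> space ?PB. \<forall>k\<in>{..n}. x k = b k}"
  let ?SV = "{x \<in> space ?PV. \<forall>k\<in>{..n}. (\<Sum>i=1..b k. g (x i)) = a k}"
  have SB: "?SB \<in> sets ?PB"
    by (intro measurable_path_event measurable_component_singleton) auto
  have SV: "?SV \<in> sets ?PV"
  proof (intro measurable_path_event measurable_count_space_sum)
    fix k i assume "i \<in> {1..b k}"
    then have "(\<lambda>x. x i) \<in> ?PV \<rightarrow>\<^sub>M count_space UNIV"
      by (intro measurable_component_singleton) auto
    then show "(\<lambda>x. g (x i)) \<in> ?PV \<rightarrow>\<^sub>M count_space UNIV"
      by (rule measurable_compose) simp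
  qed
  have E: "?E = (\<lambda>\<omega> t. B t \<omega>) -` ?SB \<inter> space M"
    by (auto simp: space_PiM)
  have F: "?F = (\<lambda>\<omega>. \<lambda>i\<in>{1..}. V i \<omega>) -` ?SV \<inter> space M"
  proof -
    have sp: "(\<lambda>i\<in>{1..}. V i \<omega>) \<in> space ?PV" for \<omega>
      by (simp add: space_PiM)
    have sum: "(\<Sum>i=1..b k. g ((\<lambda>i\<in>{1..}. V i \<omega>) i)) = ?W (b k) \<omega>" for k \<omega>
      by (rule sum.cong) auto
    show ?thesis
      by (rule set_eqI) (unfold vimage_eq Int_iff mem_Collect_eq sum, use sp in blast)
  qed
  have EF: "prob (?E \<inter> ?F) = prob ?E * prob ?F"
    using indep SB SV unfolding indep_elements_def E F
    by (intro indep_setD) blast+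
  have ev: "?E \<in> events" "?F \<in> events"
    by (intro measurable_path_event B W_meas)+
  have "\<P>(\<omega> in M. \<forall>k\<le>n. ?W (B k \<omega>) \<omega> = a k) = prob (?E \<inter> ?F)"
  proof (rule measure_eq_AE)
    show "AE \<omega> in M. \<omega> \<in> {\<omega> \<in> space M. \<forall>k\<le>n. ?W (B k \<omega>) \<omega> = a k} \<longleftrightarrow> \<omega> \<in> ?E \<inter> ?F"
      using B0 steps nonzero
    proof eventually_elim
      case (elim \<omega>)
      show ?case
        unfolding mem_Collect_eq Int_iff Ball_def atMost_iff iff[OF elim] by blast
    qed
    show "{\<omega> \<in> space M. \<forall>k\<le>n. ?W (B k \<omega>) \<omega> = a k} \<in> events"
      using measurable_path_event[where X = "\<lambda>k \<omega>. ?W (B k \<omega>) \<omega>" and K = "{..n}" and a = a] WB_meas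
      unfolding Ball_def atMost_iff by blast
    show "?E \<inter> ?F \<in> events" using ev by simp
  qed
  also have "\<dots> = prob ?E * prob ?F" by (rule EF)
  also have "prob ?E = (\<Prod>k<n. if a (Suc k) = a k then 1 - p else p)"
  proof -
    have "prob ?E = \<P>(\<omega> in M. \<forall>k\<le>n. int (B k \<omega>) = int (b k))"
      by (simp add: Ball_def)
    also have "\<dots> = (\<Prod>k<n. \<P>(\<omega> in M. int (B 1 \<omega>) = int (b (Suc k)) - int (b k)))"
      by (rule prob_increments_path[OF intB int0 ind stat]) (simp add: b0)
    also have "\<dots> = (\<Prod>k<n. if a (Suc k) = a k then 1 - p else p)"
      using intB1 by (intro prod.cong) (auto simp: b)
    finally show ?thesis .
  qed
  also have "prob ?F = (\<Prod>k<n. if a (Suc k) = a k then 1 else r (a (Suc k) - a k))"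
  proof -
    have "indep_vars (\<lambda>_. count_space UNIV) (\<lambda>i \<omega>. g (V i \<omega>)) {1..}"
      by (rule indep_vars_compose2[OF V]) simp
    from prob_walk_path[OF this r a0 b0 b] show ?thesis by (simp add: Ball_def)
  qed
  \<comment> \<open>The two products merge factor by factor: a rest gives
    \<open>(1 - p) * 1\<close>, a move gives \<open>p\<close> times the jump probability.\<close>
  finally show ?thesis
    by (auto simp: prod.distrib[symmetric] intro!: prod.cong)
qed

text \<open>Covers the paths left out by the product formulas, which assume a start at 0.\<close>

lemma prob_path_wrong_start:
  fixes X :: "nat \<Rightarrow> 'a \<Rightarrow> 's"
  assumes X: "\<And>t. X t \<in> M \<rightarrow>\<^sub>M count_space UNIV"
    and X0: "AE \<omega> in M. X 0 \<omega> = c" and "a 0 \<noteq> c"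
  shows "\<P>(\<omega> in M. \<forall>k\<le>n. X k \<omega> = a k) = 0"
proof -
  have "prob {\<omega> \<in> space M. \<forall>k\<in>{..n}. X k \<omega> = a k} = prob {}"
  proof (rule measure_eq_AE)
    show "AE \<omega> in M. \<omega> \<in> {\<omega> \<in> space M. \<forall>k\<in>{..n}. X k \<omega> = a k} \<longleftrightarrow> \<omega> \<in> {}"
      using X0
    proof eventually_elim
      case (elim \<omega>)
      have False if "\<forall>k\<in>{..n}. X k \<omega> = a k"
        using bspec[OF that, of 0] elim assms(3) by simp
      then show ?case by blast
    qed
  qed (intro measurable_path_event X sets.empty_sets)+
  then show ?thesis by (simp add: Ball_def)
qed

end

section \<open>From path probabilities to finite dimensional distributions\<close>

text \<open>Paths on \<open>{..n}\<close> form a countable set, so point masses determine the law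
  there. Any finite index set lies in some \<open>{..n}\<close>, and its law is a marginal of that
  one.\<close>

lemma same_fin_dim_distrsI:
  fixes X :: "nat \<Rightarrow> 'a \<Rightarrow> 's::countable" and Y :: "nat \<Rightarrow> 'b \<Rightarrow> 's"
  assumes "prob_space M" and "prob_space N"
    and X: "\<And>t. X t \<in> M \<rightarrow>\<^sub>M count_space UNIV" and Y: "\<And>t. Y t \<in> N \<rightarrow>\<^sub>M count_space UNIV"
    and eq: "\<And>n a. \<P>(\<omega> in M. \<forall>k\<le>n. X k \<omega> = a k) = \<P>(\<omega> in N. \<forall>k\<le>n. Y k \<omega> = a k)"
  shows "same_fin_dim_distrs M X N Y"
proof -
  interpret M: prob_space M by fact
  interpret N: prob_space N by fact
  have initial: "fin_dim_distr M X {..n} = fin_dim_distr N Y {..n}" for n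
  proof (rule measure_eqI_countable)
    let ?A = "PiE {..n} (\<lambda>_. UNIV :: 's set)"
    show "countable ?A" by (intro countable_PiE) auto
    fix a assume "a \<in> ?A"
    then have ext: "(\<lambda>t\<in>{..n}. f t) = a \<longleftrightarrow> (\<forall>k\<le>n. f k = a k)" for f
      by (auto simp: fun_eq_iff PiE_def extensional_def)
    have a: "{a} \<in> sets (Pi\<^sub>M {..n} (\<lambda>_. count_space (UNIV :: 's set)))"
      using \<open>a \<in> ?A\<close> by (simp add: count_space_PiM_finite)
    show "emeasure (fin_dim_distr M X {..n}) {a} = emeasure (fin_dim_distr N Y {..n}) {a}"
      using eq[of n a] a unfolding fin_dim_distr_def
      by (subst (1 2) emeasure_distr)
         (auto intro!: measurable_restrict X Y simp: M.emeasure_eq_measure N.emeasure_eq_measure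
            vimage_def Int_def ext conj_commute)
  qed (simp_all add: fin_dim_distr_def count_space_PiM_finite)
  \<comment> \<open>Stated for a generic process, as the two processes live on different probability
    spaces.\<close>
  have restr: "fin_dim_distr L Z J =
      distr (fin_dim_distr L Z {..n}) (Pi\<^sub>M J (\<lambda>_. count_space UNIV)) (\<lambda>x. restrict x J)"
    if "\<And>t. Z t \<in> L \<rightarrow>\<^sub>M count_space UNIV" "J \<subseteq> {..n}" for L :: "'c measure" and Z :: "nat \<Rightarrow> 'c \<Rightarrow> 's" and J n
  proof -
    have "(\<lambda>x. restrict x J) \<circ> (\<lambda>\<omega>. \<lambda>t\<in>{..n}. Z t \<omega>) = (\<lambda>\<omega>. \<lambda>t\<in>J. Z t \<omega>)"
      using that(2) by (force simp: fun_eq_iff restrict_def)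
    then show ?thesis
      unfolding fin_dim_distr_def using that
      by (subst distr_distr) (simp_all add: measurable_restrict measurable_restrict_subset)
  qed
  show ?thesis
    unfolding same_fin_dim_distrs_def
  proof (intro conjI allI impI X Y)
    fix J :: "nat set" assume "finite J"
    then obtain n where "\<forall>j\<in>J. j \<le> n" unfolding finite_nat_set_iff_bounded_le ..
    then have n: "J \<subseteq> {..n}" by auto
    show "fin_dim_distr M X J = fin_dim_distr N Y J"
      by (simp only: restr[OF X n] restr[OF Y n] initial)
  qed
qed

theorem theorem1:
  fixes M :: "'a measure" and N :: "'b measure"
    and p0 p1 p2 p :: real
    and B0 B1 B2 M1 M2 :: "nat \<Rightarrow> 'a \<Rightarrow> nat"
    and B I1 I2 I0 A1 A2 :: "nat \<Rightarrow> 'b \<Rightarrow> nat"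
  assumes "prob_space M" and "prob_space N"
    and "0 \<le> p0" and "0 \<le> p1" and "0 \<le> p2"
    and "p = p0 + p1 + p2" and "0 < p" and "p \<le> 1"
    and "multinomial_process M p0 p1 p2 B0 B1 B2"
    and "\<And>t \<omega>. M1 t \<omega> = B1 t \<omega> + B0 t \<omega>"
    and "\<And>t \<omega>. M2 t \<omega> = B2 t \<omega> + B0 t \<omega>"
    and "binomial_process N p B"
    and "iid_vars N (\<lambda>i \<omega>. (I1 i \<omega>, I2 i \<omega>, I0 i \<omega>)) {1..}"
    and "\<And>i. 1 \<le> i \<Longrightarrow>
           measure N {\<omega> \<in> space N. I1 i \<omega> = 1 \<and> I2 i \<omega> = 0 \<and> I0 i \<omega> = 0} = p1 / p"
    and "\<And>i. 1 \<le> i \<Longrightarrow>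
           measure N {\<omega> \<in> space N. I1 i \<omega> = 0 \<and> I2 i \<omega> = 1 \<and> I0 i \<omega> = 0} = p2 / p"
    and "\<And>i. 1 \<le> i \<Longrightarrow>
           measure N {\<omega> \<in> space N. I1 i \<omega> = 0 \<and> I2 i \<omega> = 0 \<and> I0 i \<omega> = 1} = p0 / p"
    and "indep_elements N
           (Pi\<^sub>M UNIV (\<lambda>_. count_space UNIV)) (\<lambda>\<omega> t. B t \<omega>)
           (Pi\<^sub>M {1..} (\<lambda>_. count_space UNIV)) (\<lambda>\<omega>. \<lambda>i\<in>{1..}. (I1 i \<omega>, I2 i \<omega>, I0 i \<omega>))"
    and "\<And>\<omega>. I1 0 \<omega> = 0" and "\<And>\<omega>. I2 0 \<omega> = 0" and "\<And>\<omega>. I0 0 \<omega> = 0"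
    and "\<And>t \<omega>. A1 t \<omega> = (\<Sum>i = 0..B t \<omega>. I1 i \<omega> + I0 i \<omega>)"
    and "\<And>t \<omega>. A2 t \<omega> = (\<Sum>i = 0..B t \<omega>. I2 i \<omega> + I0 i \<omega>)"
  shows "same_fin_dim_distrs M (\<lambda>t \<omega>. (M1 t \<omega>, M2 t \<omega>)) N (\<lambda>t \<omega>. (A1 t \<omega>, A2 t \<omega>))"
proof -
  interpret M: prob_space M by fact
  interpret N: prob_space N by fact
  note multi = assms(9)[unfolded multinomial_process_def]
  note bin = assms(12)[unfolded binomial_process_def]
  \<comment> \<open>States are moved to \<open>int\<close>, where increments make sense. The common
    component stands first in \<open>X\<close> but last in \<open>V\<close>, hence the different
    argument orders of \<open>f\<close> and \<open>g\<close>.\<close>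
  define X where "X t \<omega> = (int (B0 t \<omega>), int (B1 t \<omega>), int (B2 t \<omega>))" for t \<omega>
  define V where "V i \<omega> = (I1 i \<omega>, I2 i \<omega>, I0 i \<omega>)" for i \<omega>
  define f :: "int \<times> int \<times> int \<Rightarrow> int \<times> int" where "f = (\<lambda>(x0, x1, x2). (x1 + x0, x2 + x0))"
  define g :: "nat \<times> nat \<times> nat \<Rightarrow> int \<times> int"
    where "g = (\<lambda>(i1, i2, i0). (int (i1 + i0), int (i2 + i0)))"
  define r :: "int \<times> int \<Rightarrow> real"
    where "r y = (if y = (1, 0) then p1 / p else if y = (0, 1) then p2 / p
      else if y = (1, 1) then p0 / p else 0)" for y

  \<comment> \<open>One-step law of the multinomial side\<close>
  have B012: "B0 t \<in> M \<rightarrow>\<^sub>M count_space UNIV" "B1 t \<in> M \<rightarrow>\<^sub>M count_space UNIV"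
    "B2 t \<in> M \<rightarrow>\<^sub>M count_space UNIV" for t
    using multi by auto
  have X: "X t \<in> M \<rightarrow>\<^sub>M count_space UNIV" for t
  proof -
    have "(\<lambda>\<omega>. (B1 t \<omega>, B2 t \<omega>)) \<in> M \<rightarrow>\<^sub>M count_space UNIV"
      by (rule measurable_count_space_binary[where h = Pair, OF B012(2,3)])
    from measurable_count_space_binary[where h = "\<lambda>x (y, z). (int x, int y, int z)", OF B012(1) this]
    show ?thesis by (simp add: X_def[abs_def])
  qed
  have additive_f: "Modules.additive f"
    by unfold_locales (auto simp: f_def)
  have fX: "(\<lambda>\<omega>. f (X t \<omega>)) \<in> M \<rightarrow>\<^sub>M count_space UNIV" for t
    by (rule measurable_compose[OF X]) simp
  have fX_M: "f (X t \<omega>) = (int (M1 t \<omega>), int (M2 t \<omega>))" for t \<omega>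
    by (simp add: f_def X_def assms(10,11))
  have fX0: "AE \<omega> in M. f (X 0 \<omega>) = 0"
    using multi by (auto simp: f_def X_def zero_prod_def elim: eventually_mono)
  have ind_fX: "independent_increments M (\<lambda>t \<omega>. f (X t \<omega>))"
    by (rule independent_increments_additive[OF assms(1) additive_f])
       (use multi in \<open>simp add: X_def[abs_def]\<close>)
  have stat_fX: "stationary_increments M (\<lambda>t \<omega>. f (X t \<omega>))"
    by (rule stationary_increments_additive[OF additive_f X])
       (use multi in \<open>simp add: X_def[abs_def]\<close>)
  have X1: "\<P>(\<omega> in M. X 1 \<omega> = (int b0, int b1, int b2)) =
      (if b0 + b1 + b2 \<le> 1
       then fact 1 / (fact b0 * fact b1 * fact b2 * fact (1 - b0 - b1 - b2))
              * p0 ^ b0 * p1 ^ b1 * p2 ^ b2 * (1 - (p0 + p1 + p2)) ^ (1 - b0 - b1 - b2)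
       else 0)" for b0 b1 b2
    using multi by (simp add: X_def)
  let ?S = "{(0, 0, 0), (1, 0, 0), (0, 1, 0), (0, 0, 1)} :: (int \<times> int \<times> int) set"
  have PX1: "\<P>(\<omega> in M. X 1 \<omega> = (0, 0, 0)) = 1 - p" "\<P>(\<omega> in M. X 1 \<omega> = (1, 0, 0)) = p0"
    "\<P>(\<omega> in M. X 1 \<omega> = (0, 1, 0)) = p1" "\<P>(\<omega> in M. X 1 \<omega> = (0, 0, 1)) = p2"
    using X1[of 0 0 0] X1[of 1 0 0] X1[of 0 1 0] X1[of 0 0 1] assms(6) by simp_all
  have "AE \<omega> in M. X 1 \<omega> \<in> ?S"
    by (rule M.AE_in_finite_support[OF X]) (simp_all add: PX1[simplified] assms(6))
  \<comment> \<open>The map \<open>f\<close> is injective on \<open>?S\<close> and sends only the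
    origin to 0. Since \<open>0 < p\<close>, each weight such as \<open>p1\<close> equals
    \<open>p * (p1 / p)\<close>: first decide whether to move, then draw the direction from
    \<open>r\<close>.\<close>
  then have PfX1: "\<P>(\<omega> in M. f (X 1 \<omega>) = y) = (if y = 0 then 1 - p else p * r y)" for y
    using \<open>0 < p\<close>
    by (subst M.prob_image_finite_support[OF X, of ?S])
       (auto simp: PX1[simplified] f_def r_def zero_prod_def)

  \<comment> \<open>Jump law and clock of the subordinated side\<close>
  have V: "N.indep_vars (\<lambda>_. count_space UNIV) V {1..}"
    using assms(13) by (simp add: iid_vars_def V_def[abs_def])
  have V_meas: "V i \<in> N \<rightarrow>\<^sub>M count_space UNIV" if "1 \<le> i" for i
    using V that by (auto simp: N.indep_vars_def)
  let ?T = "{(1, 0, 0), (0, 1, 0), (0, 0, 1)} :: (nat \<times> nat \<times> nat) set"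
  have PgV: "\<P>(\<omega> in N. g (V i \<omega>) = y) = r y" if i: "1 \<le> i" for i y
  proof -
    have PV: "\<P>(\<omega> in N. V i \<omega> = (1, 0, 0)) = p1 / p" "\<P>(\<omega> in N. V i \<omega> = (0, 1, 0)) = p2 / p"
      "\<P>(\<omega> in N. V i \<omega> = (0, 0, 1)) = p0 / p"
      using assms(14-16)[OF i] by (simp_all add: V_def)
    have "p1 / p + (p2 / p + p0 / p) = 1"
      using assms(6,7) by (simp add: add_divide_distrib[symmetric])
    then have "AE \<omega> in N. V i \<omega> \<in> ?T"
      by (intro N.AE_in_finite_support[OF V_meas[OF i]]) (simp_all add: PV[simplified])
    then show ?thesis
      by (subst N.prob_image_finite_support[OF V_meas[OF i], of ?T])
         (auto simp: PV[simplified] g_def r_def)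
  qed
  have r0: "r 0 = 0"
    by (simp add: r_def zero_prod_def)
  have B: "B t \<in> N \<rightarrow>\<^sub>M count_space UNIV" for t
    using bin by auto
  have PB1: "\<P>(\<omega> in N. B 1 \<omega> = k) = pmf (binomial_pmf 1 p) k" for k
  proof -
    have "\<P>(\<omega> in N. B 1 \<omega> = k) = measure (distr N (count_space UNIV) (B 1)) {k}"
      by (subst measure_distr[OF B]) (auto intro!: arg_cong[where f = "measure N"])
    then show ?thesis using bin by (simp add: pmf.rep_eq)
  qed
  \<comment> \<open>The sums defining \<open>A1\<close> and \<open>A2\<close> start at index 0, but
    that term vanishes, so the walk may start at index 1.\<close>
  have gV_A: "(\<Sum>i=1..B t \<omega>. g (V i \<omega>)) = (int (A1 t \<omega>), int (A2 t \<omega>))" for t \<omega>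
    by (simp add: g_def V_def assms(18-22) sum.atLeast_Suc_atMost sum_prod)
  have A_meas: "(\<lambda>\<omega>. (int (A1 t \<omega>), int (A2 t \<omega>))) \<in> N \<rightarrow>\<^sub>M count_space UNIV" for t
  proof -
    have "(\<lambda>\<omega>. \<Sum>i=1..m. g (V i \<omega>)) \<in> N \<rightarrow>\<^sub>M count_space UNIV" for m
    proof (rule measurable_count_space_sum)
      fix i assume "i \<in> {1..m}"
      then have "1 \<le> i" by simp
      then show "(\<lambda>\<omega>. g (V i \<omega>)) \<in> N \<rightarrow>\<^sub>M count_space UNIV"
        by (rule measurable_compose[OF V_meas]) simp
    qed
    then show ?thesis
      unfolding gV_A[symmetric] by (rule measurable_compose_countable[OF _ B])
  qed
  have A0: "AE \<omega> in N. (int (A1 0 \<omega>), int (A2 0 \<omega>)) = 0"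
    using bin by (auto simp: gV_A[symmetric])

  \<comment> \<open>Comparison of the path probabilities\<close>
  have path: "\<P>(\<omega> in M. \<forall>k\<le>n. (int (M1 k \<omega>), int (M2 k \<omega>)) = a k) =
      \<P>(\<omega> in N. \<forall>k\<le>n. (int (A1 k \<omega>), int (A2 k \<omega>)) = a k)" for n and a :: "nat \<Rightarrow> int \<times> int"
  proof (cases "a 0 = 0")
    case True
    have "\<P>(\<omega> in M. \<forall>k\<le>n. (int (M1 k \<omega>), int (M2 k \<omega>)) = a k) =
        (\<Prod>k<n. if a (Suc k) = a k then 1 - p else p * r (a (Suc k) - a k))"
      using M.prob_increments_path[OF fX fX0 ind_fX stat_fX, of a n] True
      unfolding PfX1 by (simp add: fX_M)
    also have "\<dots> = \<P>(\<omega> in N. \<forall>k\<le>n. (\<Sum>i=1..B k \<omega>. g (V i \<omega>)) = a k)"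
    proof (rule N.prob_subordinated_path[where g = g and V = V, symmetric])
      show "\<P>(\<omega> in N. B 1 \<omega> = 0) = 1 - p" "\<P>(\<omega> in N. B 1 \<omega> = 1) = p"
        using assms(7,8) by (simp_all add: PB1[simplified])
      show "indep_elements N (Pi\<^sub>M UNIV (\<lambda>_. count_space UNIV)) (\<lambda>\<omega> t. B t \<omega>)
          (Pi\<^sub>M {1..} (\<lambda>_. count_space UNIV)) (\<lambda>\<omega>. \<lambda>i\<in>{1..}. V i \<omega>)"
        unfolding V_def by (rule assms(17))
    qed (use bin V PgV r0 True in auto)
    also have "\<dots> = \<P>(\<omega> in N. \<forall>k\<le>n. (int (A1 k \<omega>), int (A2 k \<omega>)) = a k)"
      unfolding gV_A ..
    finally show ?thesis .
  next
    case False
    have "\<P>(\<omega> in M. \<forall>k\<le>n. f (X k \<omega>) = a k) = 0"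
      by (rule M.prob_path_wrong_start[where c = 0]) (fact fX fX0 False)+
    moreover have "\<P>(\<omega> in N. \<forall>k\<le>n. (int (A1 k \<omega>), int (A2 k \<omega>)) = a k) = 0"
      by (rule N.prob_path_wrong_start[where c = 0]) (fact A_meas A0 False)+
    ultimately show ?thesis
      unfolding fX_M by simp
  qed

  show ?thesis
  proof (rule same_fin_dim_distrsI[OF assms(1,2)])
    show "(\<lambda>\<omega>. (M1 t \<omega>, M2 t \<omega>)) \<in> M \<rightarrow>\<^sub>M count_space UNIV" for t
      using measurable_compose[OF fX[of t], of "\<lambda>(x, y). (nat x, nat y)" "count_space UNIV"]
      by (simp add: fX_M)
    show "(\<lambda>\<omega>. (A1 t \<omega>, A2 t \<omega>)) \<in> N \<rightarrow>\<^sub>M count_space UNIV" for t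
      using measurable_compose[OF A_meas[of t], of "\<lambda>(x, y). (nat x, nat y)" "count_space UNIV"]
      by simp
    \<comment> \<open>The embedding of \<open>nat\<close> into \<open>int\<close> is injective, so
      following \<open>a\<close> is the same event as following its integer image.\<close>
    show "\<P>(\<omega> in M. \<forall>k\<le>n. (M1 k \<omega>, M2 k \<omega>) = a k) = \<P>(\<omega> in N. \<forall>k\<le>n. (A1 k \<omega>, A2 k \<omega>) = a k)" for n a
      using path[of n "\<lambda>k. (int (fst (a k)), int (snd (a k)))"] by (simp add: prod_eq_iff)
  qed
qed

end
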